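(* For a nonnegative integer $m$ and $n:=2^{m}$, let $g_{1},\ldots,g_{2^{m}}$ be the first $n=2^{m}$ functions of the Walsh system, and for $i,j=1,\ldots,2^{m}$ let $a_{i,j}^{(n)}$ (also written $a_{ij}^{(n)}$) be the value that $g_{j}$ takes in the interval $\left((i-1)/2^{m},\,i/2^{m}\right)$. Let $p\in[1,2]$. For every positive integer $j$, let $$A_{j}:=\left[\tfrac12+\sqrt{\tfrac14+\log_{2}\left(\tfrac{j+1}{2}\right)},\ \tfrac12+\sqrt{\tfrac14+\log_{2}j}\right]\cap\mathbb{N}.$$ Each $A_j$ contains at most one element. Define the sequence $(x^{(j)})_{j=1}^{\infty}$ in the real space $\ell_p$ by $$x^{(j)}=2^{\frac{(1-k_{j})(k_{j}(2+p)+2p)}{2p}}\cdot\sum_{s=1}^{2^{k_{j}(k_{j}-1)}} a_{rs}^{\left(2^{k_{j}(k_{j}-1)}\right)}\, e_{2^{k_{j}(k_{j}-1)}+s-1}$$ if $A_{j}\neq\emptyset$, where $k_{j}$ is the unique element of $A_{j}$ and $r=j-2^{k_{j}(k_{j}-1)}+1$, and $x^{(j)}=0$ if $A_j=\emptyset$. Then $(x^{(j)})_{j=1}^{\infty}$ is unconditionally summable in $\ell_{p}$ (over the real scalar field) and $$\sum_{j=1}^{\infty}\left\Vert x^{(j)}\right\Vert^{2-\varepsilon}=\infty$$ for all $\varepsilon>0$.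
   Context: $\mathbb{N}$ denotes the positive integers. $\ell_p$ is the Banach space of $p$-summable real sequences indexed by the positive integers, with its usual norm $\Vert\cdot\Vert$, and $(e_m)_{m=1}^\infty$ are its canonical unit vectors. A sequence $(x^{(j)})_{j=1}^\infty$ in a Banach space is unconditionally summable if the series $\sum_j x^{(j)}$ is unconditionally convergent, i.e. all rearrangements of the series converge (to the same vector). In the sum $\sum_j\Vert x^{(j)}\Vert^{2-\varepsilon}$, the indices $j$ with $x^{(j)}=0$ contribute $0$ (this convention matters only for $\varepsilon\ge 2$). The Walsh system consists of the following functions on $[0,1]$ (values at the finitely many dyadic breakpoints are left unspecified and are irrelevant): - $f_0(x)=1$ for $0\le x\le 1$. - $f_1(x)=1$ for $0\le x<\frac12$ and $f_1(x)=-1$ for $\frac12<x\le 1$. - $f_2^{(1)}(x)=1$ for $0\le x<\frac14$ and for $\frac34<x\le 1$, and $f_2^{(1)}(x)=-1$ for $\frac14<x<\frac34$. - $f_2^{(2)}(x)=1$ for $0\le x<\frac14$ and for $\frac12<x<\frac34$, and $f_2^{(2)}(x)=-1$ for $\frac14<x<\frac12$ and for $\frac34<x\le 1$. - For every integer $n\ge 2$ and $k=1,2,\ldots,2^{n-1}$: $f_{n+1}^{(2k-1)}(x)=f_n^{(k)}(2x)$ for $0\le x<\frac12$ and $f_{n+1}^{(2k-1)}(x)=(-1)^{k+1}f_n^{(k)}(2x-1)$ for $\frac12<x\le 1$; $f_{n+1}^{(2k)}(x)=f_n^{(k)}(2x)$ for $0\le x<\frac12$ and $f_{n+1}^{(2k)}(x)=(-1)^{k}f_n^{(k)}(2x-1)$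 for $\frac12<x\le 1$. The functions are enumerated as $g_1=f_0$, $g_2=f_1$, $g_3=f_2^{(1)}$, $g_4=f_2^{(2)}$, and so on: after $f_0,f_1$ come $f_n^{(1)},\ldots,f_n^{(2^{n-1})}$ for $n=2,3,\ldots$ in order. The first $2^m$ functions are constant on each interval $\left((i-1)/2^m,i/2^m\right)$, $i=1,\ldots,2^m$. *)

theory Defs
  imports "HOL-Analysis.Analysis" "HOL-Library.Log_Nat"
begin

section \<open>The Walsh system\<close>

text \<open>
  \<open>walsh n k\<close> is \<open>f_n^(k)\<close>; the superscript is ignored for \<open>n = 0\<close> and \<open>n = 1\<close>.
  Only arguments in \<open>[0,1]\<close> matter. At the dyadic breakpoints, where the functions are not
  specified, the value on the interval to the right is taken. In the recursion, the index is
  \<open>l = 2k - 1\<close> or \<open>l = 2k\<close>, so that \<open>k = (l + 1) div 2\<close>.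
\<close>

fun walsh :: "nat \<Rightarrow> nat \<Rightarrow> real \<Rightarrow> real" where
  "walsh 0 k x = 1"
| "walsh (Suc 0) k x = (if x < 1/2 then 1 else -1)"
| "walsh (Suc (Suc 0)) k x =
     (if k = 1 then (if x < 1/4 \<or> 3/4 \<le> x then 1 else -1)
      else (if x < 1/4 \<or> 1/2 \<le> x \<and> x < 3/4 then 1 else -1))"
| "walsh (Suc (Suc (Suc n))) l x =
     (let k = (l + 1) div 2 in
      if x < 1/2 then walsh (Suc (Suc n)) k (2 * x)
      else (if odd l then (-1) ^ (k + 1) else (-1) ^ k) * walsh (Suc (Suc n)) k (2 * x - 1))"

text \<open>
  \<open>walsh_enum j\<close> is \<open>g_j\<close> for \<open>j \<ge> 1\<close>. For \<open>n \<ge> 1\<close> the functions \<open>f_n^(1), \<dots>, f_n^(2^(n-1))\<close>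
  occupy the positions \<open>2^(n-1) + 1, \<dots>, 2^n\<close>, which are exactly those with \<open>ceillog2 j = n\<close>.
\<close>

definition walsh_enum :: "nat \<Rightarrow> real \<Rightarrow> real" where
  "walsh_enum j =
     (if j = 1 then walsh 0 1
      else (let n = ceillog2 j in walsh n (j - 2 ^ (n - 1))))"

text \<open>\<open>walsh_entry m i j\<close> is \<open>a_{ij}^(n)\<close> with \<open>n = 2^m\<close>, for \<open>1 \<le> i, j \<le> 2^m\<close>.\<close>

definition walsh_entry :: "nat \<Rightarrow> nat \<Rightarrow> nat \<Rightarrow> real" where
  "walsh_entry m i j =
     (THE v. \<forall>t\<in>{(real i - 1) / 2 ^ m <..< real i / 2 ^ m}. walsh_enum j t = v)"


section \<open>The real sequence spaces and unconditional summability\<close>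

text \<open>
  Sequences indexed by the positive integers are functions on \<open>nat\<close>. Elements of \<open>\<ell>_p\<close>
  vanish at the spurious index 0, so that they are determined by their values on the positive
  integers. Intended for \<open>p \<ge> 1\<close>.
\<close>

definition lp :: "real \<Rightarrow> (nat \<Rightarrow> real) set" where
  "lp p = {x. x 0 = 0 \<and> summable (\<lambda>i. \<bar>x i\<bar> powr p)}"

definition lp_norm :: "real \<Rightarrow> (nat \<Rightarrow> real) \<Rightarrow> real" where
  "lp_norm p x = (\<Sum>i. \<bar>x i\<bar> powr p) powr (1 / p)"

definition unit_vec :: "nat \<Rightarrow> nat \<Rightarrow> real" where
  "unit_vec m i = (if i = m then 1 else 0)"

text \<open>
  Every rearrangement of the series \<open>x 1 + x 2 + \<dots>\<close> converges in norm, to one and the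
  same vector (\<open>x 0\<close> is irrelevant).
\<close>

definition lp_unconditionally_summable :: "real \<Rightarrow> (nat \<Rightarrow> nat \<Rightarrow> real) \<Rightarrow> bool" where
  "lp_unconditionally_summable p x \<longleftrightarrow>
     (\<forall>j\<ge>1. x j \<in> lp p) \<and>
     (\<exists>S\<in>lp p. \<forall>\<pi>. bij_betw \<pi> {1..} {1..} \<longrightarrow>
        (\<lambda>N. lp_norm p (\<lambda>i. (\<Sum>j=1..N. x (\<pi> j) i) - S i)) \<longlonglongrightarrow> 0)"


section \<open>The sequence of vectors\<close>

text \<open>\<open>index_set j\<close> is \<open>A_j\<close> and \<open>walsh_vec p j\<close> is \<open>x^(j)\<close>, for \<open>j \<ge> 1\<close>.\<close>

definition index_set :: "nat \<Rightarrow> nat set" where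
  "index_set j = {k. k \<ge> 1 \<and>
     real k \<in> {1/2 + sqrt (1/4 + log 2 ((real j + 1) / 2)) .. 1/2 + sqrt (1/4 + log 2 (real j))}}"

definition walsh_vec :: "real \<Rightarrow> nat \<Rightarrow> nat \<Rightarrow> real" where
  "walsh_vec p j =
     (if index_set j = {} then (\<lambda>i. 0)
      else let k = (THE k. k \<in> index_set j); M = 2 ^ (k * (k - 1)); r = j - M + 1
           in (\<lambda>i. 2 powr ((1 - real k) * (real k * (2 + p) + 2 * p) / (2 * p)) *
                   (\<Sum>s=1..M. walsh_entry (k * (k - 1)) r s * unit_vec (M + s - 1) i)))"

end

theory Submission
  imports Defs
begin

text \<open>
  \<open>A_j = {k}\<close> holds exactly when \<open>M \<le> j < 2 M\<close> with \<open>M = 2^(k (k - 1))\<close>, and then \<open>x^(j)\<close> is a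
  multiple of a row of the Walsh matrix of order \<open>M\<close>, supported on the coordinates \<open>M, \<dots>, 2 M - 1\<close>.
  Its norm is \<open>M^(-1/2) 2^(1-k)\<close>, so the block \<open>k\<close> contributes
  \<open>2^((k - 1) (k \<epsilon>/2 - 2 + \<epsilon>))\<close> to the sum of the powers \<open>2 - \<epsilon>\<close>, which is unbounded in \<open>k\<close>.
  On the other hand the rows of the Walsh matrix are orthogonal, so that any sum of distinct rows
  has \<open>\<ell>_2\<close> norm at most \<open>M\<close> and hence, since \<open>p \<le> 2\<close>, \<open>\<ell>_p\<close> norm at most \<open>M^(1/p + 1/2)\<close>.
  The normalisation makes every subsum of the block \<open>k\<close> have norm at most \<open>2^(1-k)\<close>.
  Different blocks have disjoint supports, so the remainder of any rearranged series tends to 0.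
\<close>

section \<open>Walsh functions: recursion, sample values and orthogonality\<close>

lemma sum_pairs:
  fixes F :: "nat \<Rightarrow> 'a::comm_monoid_add"
  shows "sum F {1..2 * n} = (\<Sum>j=1..n. F (2 * j - 1) + F (2 * j))"
proof (induction n)
  case (Suc n)
  have "{1..2 * Suc n} = insert (2 * n + 2) (insert (2 * n + 1) {1..2 * n})" by auto
  then show ?case using Suc by (simp add: ac_simps)
qed simp

text \<open>The two children of \<open>f_n^(k)\<close> in the recursion are
  \<open>f_(n+1)^(2k-1)\<close> and \<open>f_(n+1)^(2k)\<close>; in the enumeration these become the
  positions \<open>2 * j - 1\<close> and \<open>2 * j\<close>. Both copy the parent on the left
  half, while on the right half the signs \<open>(-1)^(k+1)\<close> and \<open>(-1)^k\<close> are
  opposite. Stated through \<open>walsh_enum\<close>, this hides the level and the special first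
  clauses.\<close>

lemma walsh_enum_double:
  assumes "j \<ge> 1"
  shows walsh_enum_left: "x < 1/2 \<Longrightarrow> walsh_enum (2 * j - 1) x = walsh_enum j (2 * x)"
      "x < 1/2 \<Longrightarrow> walsh_enum (2 * j) x = walsh_enum j (2 * x)"
    and walsh_enum_right: "\<exists>\<sigma>\<in>{1,-1}. \<forall>x\<ge>1/2. walsh_enum (2 * j - 1) x = \<sigma> * walsh_enum j (2 * x - 1) \<and>
      walsh_enum (2 * j) x = - \<sigma> * walsh_enum j (2 * x - 1)"
proof -
  have "(x < 1/2 \<longrightarrow> walsh_enum (2 * j - 1) x = walsh_enum j (2 * x) \<and>
          walsh_enum (2 * j) x = walsh_enum j (2 * x)) \<and>
        (\<exists>\<sigma>\<in>{1,-1}. \<forall>x\<ge>1/2. walsh_enum (2 * j - 1) x = \<sigma> * walsh_enum j (2 * x - 1) \<and>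
          walsh_enum (2 * j) x = - \<sigma> * walsh_enum j (2 * x - 1))"
  proof (cases "j = 1")
    case True
    then show ?thesis by (auto simp: walsh_enum_def)
  next
    case False
    define n where "n = ceillog2 j"
    have j: "j \<ge> 2" using assms False by simp
    have "n \<noteq> 0" unfolding n_def using ceillog2_le_iff[of j 0] j by auto
    then obtain q where q: "n = Suc q" by (cases n) auto
    have lower: "2 ^ q < j"
      using two_power_ceillog2_gt[of j] j by (simp add: n_def[symmetric] q)
    define k where "k = j - 2 ^ q"
    have k: "k \<ge> 1" "j = 2 ^ q + k" using lower by (auto simp: k_def)
    have even: "ceillog2 (2 * j) = Suc n" using j by (simp add: ceillog2_rec_even n_def)
    have odd: "ceillog2 (2 * j - 1) = Suc n"
    proof -
      obtain i where i: "j = Suc i" "i > 0" using j by (cases j) auto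
      show ?thesis using ceillog2_rec_odd[OF i(2)] by (simp add: n_def i)
    qed
    have vals: "walsh_enum j = walsh (Suc q) k"
      "walsh_enum (2 * j - 1) = walsh (Suc (Suc q)) (2 * k - 1)"
      "walsh_enum (2 * j) = walsh (Suc (Suc q)) (2 * k)"
    proof -
      have "j \<noteq> 1" "2 * j - 1 \<noteq> 1" "2 * j \<noteq> 1"
        "j - 2 ^ q = k" "2 * j - 1 - 2 ^ Suc q = 2 * k - 1" "2 * j - 2 ^ Suc q = 2 * k"
        using j k by auto
      then show "walsh_enum j = walsh (Suc q) k"
        "walsh_enum (2 * j - 1) = walsh (Suc (Suc q)) (2 * k - 1)"
        "walsh_enum (2 * j) = walsh (Suc (Suc q)) (2 * k)"
        unfolding walsh_enum_def Let_def even odd n_def[symmetric] q by simp_all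
    qed
    show ?thesis
    \<comment> \<open>For \<open>q = 0\<close> the parent is \<open>f_1\<close>, whose children are
      given explicitly; the general recursion only starts one level higher.\<close>
    proof (cases q)
      case 0
      have "j \<le> 2 ^ n" unfolding n_def by (rule le_two_power_ceillog2)
      then have "k = 1" using k by (simp add: q 0)
      then show ?thesis unfolding vals 0 by auto
    next
      case (Suc i)
      have kk: "odd (2 * k - 1)" "(2 * k - 1 + 1) div 2 = k" "(2 * k + 1) div 2 = k" using k by auto
      show ?thesis unfolding vals Suc walsh.simps Let_def kk
        using kk(1) by (auto simp: uminus_power_if)
    qed
  qed
  then show "x < 1/2 \<Longrightarrow> walsh_enum (2 * j - 1) x = walsh_enum j (2 * x)"
      "x < 1/2 \<Longrightarrow> walsh_enum (2 * j) x = walsh_enum j (2 * x)"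
      "\<exists>\<sigma>\<in>{1,-1}. \<forall>x\<ge>1/2. walsh_enum (2 * j - 1) x = \<sigma> * walsh_enum j (2 * x - 1) \<and>
      walsh_enum (2 * j) x = - \<sigma> * walsh_enum j (2 * x - 1)"
    by auto
qed

lemma odd_even_index_cases:
  assumes "j \<in> {1..2 ^ Suc m}"
  obtains j' :: nat where "j' \<in> {1..2 ^ m}" "j = 2 * j' - 1" | j' where "j' \<in> {1..2 ^ m}" "j = 2 * j'"
proof -
  have "(j + 1) div 2 \<in> {1..2 ^ m}" using assms by auto
  moreover have "j = 2 * ((j + 1) div 2) - 1 \<or> j = 2 * ((j + 1) div 2)" using assms by (cases "even j") auto
  ultimately show thesis using that by metis
qed

text \<open>Induction on \<open>m\<close>: a dyadic interval lies in one half of the unit interval,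
  and stretching that half gives a dyadic interval of the previous level. The intervals are closed
  on the left because \<open>walsh\<close> takes the value from the right at breakpoints, so that
  sampling at left endpoints is allowed.\<close>

lemma walsh_enum_constant:
  assumes "j \<in> {1..2 ^ m}" "i < 2 ^ m"
    and "s \<in> {real i / 2 ^ m..<(real i + 1) / 2 ^ m}" "t \<in> {real i / 2 ^ m..<(real i + 1) / 2 ^ m}"
  shows "walsh_enum j s = walsh_enum j t"
  using assms
proof (induction m arbitrary: i j s t)
  case 0
  then show ?case by (auto simp: walsh_enum_def)
next
  case (Suc m)
  have half: "walsh_enum (2 * j' - 1) s = walsh_enum (2 * j' - 1) t \<and>
      walsh_enum (2 * j') s = walsh_enum (2 * j') t" if j': "j' \<in> {1..2 ^ m}" for j'
  proof (cases "i < 2 ^ m")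
    case True
    then have "real i + 1 \<le> 2 ^ m"
      by (metis Suc_leI of_nat_Suc of_nat_le_iff of_nat_numeral of_nat_power add.commute)
    then have "(real i + 1) / 2 ^ Suc m \<le> 1/2" by (simp add: field_simps)
    then have "s < 1/2" "t < 1/2"
      using Suc.prems(3,4) by (meson atLeastLessThan_iff order_less_le_trans)+
    moreover have "walsh_enum j' (2 * s) = walsh_enum j' (2 * t)"
      by (rule Suc.IH[OF j' True]) (use Suc.prems in \<open>auto simp: field_simps\<close>)
    ultimately show ?thesis using walsh_enum_left[of j'] j' by auto
  next
    case False
    then have i: "real (i - 2 ^ m) = real i - 2 ^ m" by simp
    have "2 ^ m \<le> real i" using False
      by (metis linorder_not_less of_nat_le_iff of_nat_numeral of_nat_power)
    then have "1/2 \<le> real i / 2 ^ Suc m" by (simp add: field_simps)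
    then have "s \<ge> 1/2" "t \<ge> 1/2"
      using Suc.prems(3,4) by (meson atLeastLessThan_iff order_trans)+
    moreover have "walsh_enum j' (2 * s - 1) = walsh_enum j' (2 * t - 1)"
      by (rule Suc.IH[OF j', of "i - 2 ^ m"]) (use Suc.prems False in \<open>auto simp: i field_simps\<close>)
    ultimately show ?thesis using walsh_enum_right[of j'] j' by auto
  qed
  show ?case using Suc.prems(1)
    by (rule odd_even_index_cases) (use half in auto)
qed

text \<open>The row index \<open>i\<close> of \<open>walsh_sample\<close> starts at 0, the column index \<open>j\<close> at 1.\<close>

definition walsh_sample :: "nat \<Rightarrow> nat \<Rightarrow> nat \<Rightarrow> real" where
  "walsh_sample m i j = walsh_enum j (real i / 2 ^ m)"

lemma walsh_entry_eq_sample: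
  assumes "j \<in> {1..2 ^ m}" "i < 2 ^ m"
  shows "walsh_entry m (Suc i) j = walsh_sample m i j"
proof -
  let ?I = "{(real (Suc i) - 1) / 2 ^ m<..<real (Suc i) / 2 ^ m}"
  have const: "walsh_enum j t = walsh_sample m i j" if "t \<in> ?I" for t
    unfolding walsh_sample_def
    by (rule walsh_enum_constant[OF assms]) (use that in \<open>auto simp: field_simps\<close>)
  \<comment> \<open>The midpoint shows that the interval is nonempty, which makes the value selected
    by \<open>THE\<close> unique.\<close>
  have "(real i + 1/2) / 2 ^ m \<in> ?I" by (simp add: field_simps)
  then have "v = walsh_sample m i j" if "\<forall>t\<in>?I. walsh_enum j t = v" for v
    using that const by metis
  then show ?thesis unfolding walsh_entry_def using const by (intro the_equality) auto
qed

lemma walsh_sample_Suc_left: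
  assumes "j \<ge> 1" "i < 2 ^ m"
  shows "walsh_sample (Suc m) i (2 * j - 1) = walsh_sample m i j"
    "walsh_sample (Suc m) i (2 * j) = walsh_sample m i j"
proof -
  have "real i < 2 ^ m"
    using assms(2) by (metis of_nat_less_iff of_nat_numeral of_nat_power)
  then have "real i / 2 ^ Suc m < 1/2" by (simp add: field_simps)
  then show "walsh_sample (Suc m) i (2 * j - 1) = walsh_sample m i j"
    "walsh_sample (Suc m) i (2 * j) = walsh_sample m i j"
    using walsh_enum_left[OF assms(1), of "real i / 2 ^ Suc m"] by (simp_all add: walsh_sample_def)
qed

text \<open>The sign is chosen before the row: it depends on the column only, so it cancels in
  products of two lower rows.\<close>

lemma walsh_sample_Suc_right:
  assumes "j \<ge> 1"
  shows "\<exists>\<sigma>\<in>{1,-1}. \<forall>i. walsh_sample (Suc m) (2 ^ m + i) (2 * j - 1) = \<sigma> * walsh_sample m i j \<and>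
    walsh_sample (Suc m) (2 ^ m + i) (2 * j) = - \<sigma> * walsh_sample m i j"
proof -
  obtain \<sigma> where \<sigma>: "\<sigma> \<in> {1,-1}" "\<And>x. x \<ge> 1/2 \<Longrightarrow>
      walsh_enum (2 * j - 1) x = \<sigma> * walsh_enum j (2 * x - 1) \<and>
      walsh_enum (2 * j) x = - \<sigma> * walsh_enum j (2 * x - 1)"
    using walsh_enum_right[OF assms] by blast
  have "real (2 ^ m + i) / 2 ^ Suc m \<ge> 1/2" "2 * (real (2 ^ m + i) / 2 ^ Suc m) - 1 = real i / 2 ^ m" for i
    by (simp_all add: field_simps)
  then show ?thesis using \<sigma> unfolding walsh_sample_def by metis
qed

lemma abs_walsh_sample:
  assumes "j \<in> {1..2 ^ m}" "i < 2 ^ m"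
  shows "\<bar>walsh_sample m i j\<bar> = 1"
  using assms
proof (induction m arbitrary: i j)
  case 0
  then show ?case by (simp add: walsh_sample_def walsh_enum_def)
next
  case (Suc m)
  have "\<bar>walsh_sample (Suc m) i (2 * j' - 1)\<bar> = 1 \<and> \<bar>walsh_sample (Suc m) i (2 * j')\<bar> = 1"
    if j': "j' \<in> {1..2 ^ m}" for j'
  proof (cases "i < 2 ^ m")
    case True
    then show ?thesis using walsh_sample_Suc_left[of j' i m] Suc.IH[OF j' True] j' by simp
  next
    case False
    define i' where "i' = i - 2 ^ m"
    have i: "i = 2 ^ m + i'" "i' < 2 ^ m" using False Suc.prems by (auto simp: i'_def)
    have "j' \<ge> 1" using j' by simp
    then obtain \<sigma> where "\<sigma> \<in> {1,-1}" "walsh_sample (Suc m) i (2 * j' - 1) = \<sigma> * walsh_sample m i' j'"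
      "walsh_sample (Suc m) i (2 * j') = - \<sigma> * walsh_sample m i' j'"
      using walsh_sample_Suc_right[of j' m] unfolding i by blast
    then show ?thesis using Suc.IH[OF j' i(2)] by (auto simp: abs_mult)
  qed
  then show ?case using odd_even_index_cases[OF Suc.prems(1)] by metis
qed

text \<open>The columns are grouped in pairs \<open>2 * j - 1\<close>, \<open>2 * j\<close>. For two
  rows in the same half, both columns of a pair contribute the product from level \<open>m\<close>,
  so the inner product doubles. For rows in different halves the two contributions cancel.\<close>

lemma walsh_sample_orthogonal:
  assumes "i < 2 ^ m" "i' < 2 ^ m"
  shows "(\<Sum>s=1..2 ^ m. walsh_sample m i s * walsh_sample m i' s) = (if i = i' then 2 ^ m else 0)"
  using assms
proof (induction m arbitrary: i i')
  case 0
  then show ?case by (simp add: walsh_sample_def walsh_enum_def)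
next
  case (Suc m)
  let ?a = "walsh_sample m" and ?b = "walsh_sample (Suc m)"
  have "\<forall>j\<in>{1..2 ^ m}. \<exists>\<sigma>\<in>{1,-1}. \<forall>i. ?b (2 ^ m + i) (2 * j - 1) = \<sigma> * ?a i j \<and>
      ?b (2 ^ m + i) (2 * j) = - \<sigma> * ?a i j"
    using walsh_sample_Suc_right by auto
  then obtain \<sigma> where \<sigma>: "\<And>j. j \<in> {1..2 ^ m} \<Longrightarrow> \<sigma> j \<in> {1,-1}"
      "\<And>j i. j \<in> {1..2 ^ m} \<Longrightarrow> ?b (2 ^ m + i) (2 * j - 1) = \<sigma> j * ?a i j"
      "\<And>j i. j \<in> {1..2 ^ m} \<Longrightarrow> ?b (2 ^ m + i) (2 * j) = - \<sigma> j * ?a i j"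
    by metis
  have sq: "\<sigma> j * \<sigma> j = 1" if "j \<in> {1..2 ^ m}" for j using \<sigma>(1)[OF that] by auto
  have pairs: "(\<Sum>s=1..2 ^ Suc m. ?b i s * ?b i' s) =
      (\<Sum>j=1..2 ^ m. ?b i (2 * j - 1) * ?b i' (2 * j - 1) + ?b i (2 * j) * ?b i' (2 * j))"
    using sum_pairs[of "\<lambda>s. ?b i s * ?b i' s" "2 ^ m"] by simp
  have halves: "l < 2 ^ m \<or> (\<exists>l'. l = 2 ^ m + l' \<and> l' < 2 ^ m)" if "l < 2 ^ Suc m" for l :: nat
    using that by (cases "l < 2 ^ m") (auto intro!: exI[of _ "l - 2 ^ m"])
  consider "i < 2 ^ m" "i' < 2 ^ m" | l where "i < 2 ^ m" "i' = 2 ^ m + l" "l < 2 ^ m"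
    | l where "i = 2 ^ m + l" "l < 2 ^ m" "i' < 2 ^ m"
    | l l' where "i = 2 ^ m + l" "l < 2 ^ m" "i' = 2 ^ m + l'" "l' < 2 ^ m"
    using halves[OF Suc.prems(1)] halves[OF Suc.prems(2)] by blast
  then show ?case
  proof cases
    case 1
    have "(\<Sum>s=1..2 ^ Suc m. ?b i s * ?b i' s) = (\<Sum>j=1..2 ^ m. 2 * (?a i j * ?a i' j))"
      unfolding pairs
    proof (rule sum.cong)
      fix j assume "j \<in> {1..2 ^ m :: nat}"
      then have "j \<ge> 1" by simp
      show "?b i (2 * j - 1) * ?b i' (2 * j - 1) + ?b i (2 * j) * ?b i' (2 * j) = 2 * (?a i j * ?a i' j)"
        unfolding walsh_sample_Suc_left[OF \<open>j \<ge> 1\<close> 1(1)] walsh_sample_Suc_left[OF \<open>j \<ge> 1\<close> 1(2)]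
        by simp
    qed simp
    also have "\<dots> = 2 * (if i = i' then 2 ^ m else 0)"
      using Suc.IH[OF 1] by (simp add: sum_distrib_left[symmetric])
    finally show ?thesis by simp
  next
    case (2 l)
    have "(\<Sum>s=1..2 ^ Suc m. ?b i s * ?b i' s) = (\<Sum>j\<in>{1..2 ^ m :: nat}. 0)"
      unfolding pairs unfolding 2(2)
    proof (rule sum.cong)
      fix j assume j: "j \<in> {1..2 ^ m :: nat}"
      then have "j \<ge> 1" by simp
      show "?b i (2 * j - 1) * ?b (2 ^ m + l) (2 * j - 1) + ?b i (2 * j) * ?b (2 ^ m + l) (2 * j) = 0"
        unfolding walsh_sample_Suc_left[OF \<open>j \<ge> 1\<close> 2(1)] \<sigma>(2)[OF j] \<sigma>(3)[OF j] by simp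
    qed simp
    then show ?thesis using 2 by simp
  next
    case (3 l)
    have "(\<Sum>s=1..2 ^ Suc m. ?b i s * ?b i' s) = (\<Sum>j\<in>{1..2 ^ m :: nat}. 0)"
      unfolding pairs unfolding 3(1)
    proof (rule sum.cong)
      fix j assume j: "j \<in> {1..2 ^ m :: nat}"
      then have "j \<ge> 1" by simp
      show "?b (2 ^ m + l) (2 * j - 1) * ?b i' (2 * j - 1) + ?b (2 ^ m + l) (2 * j) * ?b i' (2 * j) = 0"
        unfolding walsh_sample_Suc_left[OF \<open>j \<ge> 1\<close> 3(3)] \<sigma>(2)[OF j] \<sigma>(3)[OF j] by simp
    qed simp
    then show ?thesis using 3 by simp
  next
    case (4 l l')
    have "(\<Sum>s=1..2 ^ Suc m. ?b i s * ?b i' s) = (\<Sum>j=1..2 ^ m. 2 * (?a l j * ?a l' j))"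
      unfolding pairs unfolding 4(1) 4(3)
    proof (rule sum.cong)
      fix j assume j: "j \<in> {1..2 ^ m :: nat}"
      then show "?b (2 ^ m + l) (2 * j - 1) * ?b (2 ^ m + l') (2 * j - 1) +
          ?b (2 ^ m + l) (2 * j) * ?b (2 ^ m + l') (2 * j) = 2 * (?a l j * ?a l' j)"
        unfolding \<sigma>(2)[OF j] \<sigma>(3)[OF j] using sq[OF j] by algebra
    qed simp
    also have "\<dots> = 2 * (if l = l' then 2 ^ m else 0)"
      using Suc.IH[OF 4(2) 4(4)] by (simp add: sum_distrib_left[symmetric])
    finally show ?thesis using 4 by simp
  qed
qed

text \<open>Expanding the square and summing over the columns first leaves only the diagonal terms,
  by orthogonality of the rows.\<close>

lemma walsh_sample_parseval:
  assumes "D \<subseteq> {..<2 ^ m}"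
  shows "(\<Sum>s=1..2 ^ m. (\<Sum>r\<in>D. walsh_sample m r s)\<^sup>2) = real (card D) * 2 ^ m"
proof -
  have fin: "finite D" using assms finite_subset by blast
  have "(\<Sum>s=1..2 ^ m. (\<Sum>r\<in>D. walsh_sample m r s)\<^sup>2)
      = (\<Sum>s=1..2 ^ m. \<Sum>r\<in>D. \<Sum>r'\<in>D. walsh_sample m r s * walsh_sample m r' s)"
    by (simp add: power2_eq_square sum_product)
  also have "\<dots> = (\<Sum>r\<in>D. \<Sum>r'\<in>D. \<Sum>s=1..2 ^ m. walsh_sample m r s * walsh_sample m r' s)"
    by (subst sum.swap) (intro sum.cong refl sum.swap)
  also have "\<dots> = (\<Sum>r\<in>D. \<Sum>r'\<in>D. if r = r' then 2 ^ m else 0)"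
    by (intro sum.cong refl walsh_sample_orthogonal) (use assms in auto)
  also have "\<dots> = real (card D) * 2 ^ m" using fin by simp
  finally show ?thesis .
qed

section \<open>Comparison of \<open>p\<close>-th powers with squares\<close>

text \<open>The right-hand side is the tangent at \<open>u = 1\<close> of a concave power; the bound
  is Young's inequality for \<open>u\<close> and \<open>1\<close> with weights \<open>a\<close> and
  \<open>1 - a\<close>.\<close>

lemma powr_le_affine:
  fixes u a :: real
  assumes "0 \<le> u" "0 \<le> a" "a \<le> 1"
  shows "u powr a \<le> a * u + (1 - a)"
proof (cases "u = 0")
  case False
  then show ?thesis using Youngs_inequality_0[of a "1 - a" u 1] assms by simp
qed (use assms in auto)

text \<open>This is the power mean inequality. The numbers \<open>(y s)^2 / M\<close> have mean at
  most 1, and the tangent bound with exponent \<open>p/2\<close> carries this over to their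
  powers.\<close>

lemma sum_powr_le_of_sum_squares:
  fixes y :: "'a \<Rightarrow> real" and p M :: real
  assumes "0 \<le> p" "p \<le> 2" "0 < M" "real (card A) = M" "(\<Sum>s\<in>A. (y s)\<^sup>2) \<le> M\<^sup>2"
  shows "(\<Sum>s\<in>A. \<bar>y s\<bar> powr p) \<le> M powr (1 + p/2)"
proof -
  have eq: "\<bar>y s\<bar> powr p = M powr (p/2) * ((y s)\<^sup>2 / M) powr (p/2)" for s
  proof -
    have "((y s)\<^sup>2) powr (p/2) = \<bar>y s\<bar> powr p"
    proof (cases "y s = 0")
      case False
      then have "(y s)\<^sup>2 = \<bar>y s\<bar> powr 2" by simp
      then show ?thesis by (simp only: powr_powr) simp
    qed simp
    then show ?thesis using assms(3) by (simp add: powr_divide)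
  qed
  have "(\<Sum>s\<in>A. ((y s)\<^sup>2 / M) powr (p/2)) \<le> (\<Sum>s\<in>A. p/2 * ((y s)\<^sup>2 / M) + (1 - p/2))"
    by (intro sum_mono powr_le_affine) (use assms in auto)
  also have "\<dots> = p/2 * ((\<Sum>s\<in>A. (y s)\<^sup>2) / M) + M * (1 - p/2)"
    by (simp add: sum.distrib assms(4) sum_distrib_left sum_divide_distrib)
  also have "\<dots> \<le> p/2 * M + M * (1 - p/2)"
    using assms by (intro add_right_mono mult_left_mono) (auto simp: divide_le_eq power2_eq_square)
  also have "\<dots> = M" by (simp add: algebra_simps)
  finally have "(\<Sum>s\<in>A. \<bar>y s\<bar> powr p) \<le> M powr (p/2) * M"
    unfolding eq sum_distrib_left[symmetric] by (intro mult_left_mono) auto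
  then show ?thesis using assms(3) by (simp add: powr_add ac_simps)
qed


section \<open>Blocks of indices and the shape of the vectors\<close>

text \<open>The same set serves twice: as the indices \<open>j\<close> with \<open>A_j = {k}\<close>
  and as the coordinates on which these vectors live.\<close>

definition walsh_block :: "nat \<Rightarrow> nat set" where
  "walsh_block k = {2 ^ (k * (k - 1))..<2 * 2 ^ (k * (k - 1))}"

lemma finite_walsh_block [simp]: "finite (walsh_block k)"
  and card_walsh_block [simp]: "card (walsh_block k) = 2 ^ (k * (k - 1))"
  by (auto simp: walsh_block_def)

lemma real_pronic:
  assumes "k \<ge> (1::nat)"
  shows "real (k * (k - 1)) = real k * (real k - 1)"
  using assms by (simp add: of_nat_diff)

text \<open>Completing the square, \<open>(k - 1/2)^2 = 1/4 + k (k - 1)\<close>, turns the two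
  endpoint conditions into \<open>log 2 ((j + 1) / 2) \<le> k (k - 1) \<le> log 2 j\<close>.\<close>

lemma index_set_iff:
  assumes "j \<ge> 1"
  shows "k \<in> index_set j \<longleftrightarrow> k \<ge> 1 \<and> j \<in> walsh_block k"
proof (cases "k \<ge> 1")
  case True
  let ?m = "k * (k - 1)"
  define x where "x = real k - 1/2"
  have x: "x \<ge> 0" "x\<^sup>2 = 1/4 + real ?m"
    using True by (auto simp: x_def real_pronic power2_eq_square algebra_simps)
  have sx: "x = sqrt (x\<^sup>2)" using x(1) by simp
  have "1/2 + sqrt (1/4 + log 2 ((real j + 1) / 2)) \<le> real k \<longleftrightarrow>
      sqrt (1/4 + log 2 ((real j + 1) / 2)) \<le> x" by (auto simp: x_def)
  also have "\<dots> \<longleftrightarrow> log 2 ((real j + 1) / 2) \<le> real ?m"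
    by (subst sx) (simp only: real_sqrt_le_iff x(2) add_le_cancel_left)
  also have "\<dots> \<longleftrightarrow> (real j + 1) / 2 \<le> 2 ^ ?m"
    by (subst log_le_iff) (auto simp: powr_realpow simp del: of_nat_mult)
  also have "\<dots> \<longleftrightarrow> real (j + 1) \<le> real (2 * 2 ^ ?m)" by (simp add: field_simps)
  also have "\<dots> \<longleftrightarrow> j < 2 * 2 ^ ?m" unfolding of_nat_le_iff by auto
  finally have upper: "1/2 + sqrt (1/4 + log 2 ((real j + 1) / 2)) \<le> real k \<longleftrightarrow> j < 2 * 2 ^ ?m" .
  have "real k \<le> 1/2 + sqrt (1/4 + log 2 (real j)) \<longleftrightarrow> x \<le> sqrt (1/4 + log 2 (real j))"
    by (auto simp: x_def)
  also have "\<dots> \<longleftrightarrow> real ?m \<le> log 2 (real j)"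
    by (subst sx) (simp only: real_sqrt_le_iff x(2) add_le_cancel_left)
  also have "\<dots> \<longleftrightarrow> 2 ^ ?m \<le> real j"
    using assms by (subst le_log_iff) (auto simp: powr_realpow simp del: of_nat_mult)
  also have "\<dots> \<longleftrightarrow> 2 ^ ?m \<le> j"
    by (metis of_nat_le_iff of_nat_numeral of_nat_power)
  finally have lower: "real k \<le> 1/2 + sqrt (1/4 + log 2 (real j)) \<longleftrightarrow> 2 ^ ?m \<le> j" .
  show ?thesis using True upper lower by (auto simp: index_set_def walsh_block_def)
qed (simp add: index_set_def)

text \<open>The exponent \<open>k * (k - 1)\<close> increases strictly from \<open>k = 1\<close> on,
  so each block ends before the next power of two in the list starts. The blocks for 0 and 1
  coincide, whence \<open>1 \<le> k\<close>.\<close>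

lemma walsh_block_less:
  assumes "1 \<le> k" "k < k'" "i \<in> walsh_block k"
  shows "i < 2 ^ (k' * (k' - 1))"
proof -
  have "k * (k - 1) < k' * (k' - 1)"
    using assms(1,2) by (intro mult_le_less_imp_less) auto
  then have "(2::nat) ^ Suc (k * (k - 1)) \<le> 2 ^ (k' * (k' - 1))"
    by (intro power_increasing) auto
  then show ?thesis using assms(3) by (auto simp: walsh_block_def)
qed

lemma walsh_block_unique:
  assumes "i \<in> walsh_block k" "i \<in> walsh_block k'"
    and "1 \<le> k" "1 \<le> k'"
  shows "k = k'"
proof (rule ccontr)
  assume "k \<noteq> k'"
  then consider "k < k'" | "k' < k" by linarith
  then show False
    using walsh_block_less[of k k' i] walsh_block_less[of k' k i] assms
    by cases (auto simp: walsh_block_def)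
qed

lemma index_set_eq_singleton:
  assumes "k \<ge> 1" "j \<in> walsh_block k"
  shows "index_set j = {k}"
proof -
  have "j \<ge> 1" using assms(2) by (auto simp: walsh_block_def intro: order_trans[rotated])
  then show ?thesis using index_set_iff[of j] walsh_block_unique[of j] assms by auto
qed

definition walsh_coeff :: "real \<Rightarrow> nat \<Rightarrow> real" where
  "walsh_coeff p k = 2 powr ((1 - real k) * (real k * (2 + p) + 2 * p) / (2 * p))"

lemma walsh_vec_in_block:
  assumes "k \<ge> 1" "j \<in> walsh_block k"
  defines "m \<equiv> k * (k - 1)"
  shows "walsh_vec p j i = (if i \<in> walsh_block k
    then walsh_coeff p k * walsh_sample m (j - 2 ^ m) (Suc (i - 2 ^ m)) else 0)"
proof -
  let ?M = "2 ^ m :: nat"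
  have j: "j - ?M < ?M" using assms by (auto simp: walsh_block_def)
  have "walsh_vec p j i =
      walsh_coeff p k * (\<Sum>s=1..?M. walsh_entry m (Suc (j - ?M)) s * unit_vec (?M + s - 1) i)"
    using index_set_eq_singleton[OF assms(1,2)]
    by (simp add: walsh_vec_def walsh_coeff_def m_def Let_def)
  also have "(\<Sum>s=1..?M. walsh_entry m (Suc (j - ?M)) s * unit_vec (?M + s - 1) i)
      = (\<Sum>s=1..?M. if s = Suc i - ?M then walsh_sample m (j - ?M) s else 0)"
  proof (rule sum.cong)
    fix s assume s: "s \<in> {1..?M}"
    \<comment> \<open>For \<open>i < ?M\<close> the truncated difference is 0, which is outside the
      range of \<open>s\<close>, so coordinates left of the block get the value 0.\<close>
    then have "i = ?M + s - 1 \<longleftrightarrow> s = Suc i - ?M" by auto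
    then show "walsh_entry m (Suc (j - ?M)) s * unit_vec (?M + s - 1) i =
        (if s = Suc i - ?M then walsh_sample m (j - ?M) s else 0)"
      using walsh_entry_eq_sample[OF s j] by (simp add: unit_vec_def)
  qed simp
  also have "\<dots> = (if i \<in> walsh_block k then walsh_sample m (j - ?M) (Suc (i - ?M)) else 0)"
    by (auto simp: walsh_block_def m_def Suc_diff_le)
  finally show ?thesis by simp
qed

lemma walsh_vec_nonzero:
  assumes "j \<ge> 1" "walsh_vec p j i \<noteq> 0"
  obtains k where "k \<ge> 1" "j \<in> walsh_block k" "i \<in> walsh_block k"
proof -
  have "index_set j \<noteq> {}" using assms(2) by (auto simp: walsh_vec_def)
  then obtain k where "k \<ge> 1" "j \<in> walsh_block k" using index_set_iff[OF assms(1)] by auto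
  then show thesis using that walsh_vec_in_block[of k j p i] assms(2) by (auto split: if_splits)
qed

text \<open>With \<open>M = 2^(k (k - 1))\<close> the coefficient is \<open>M^(-(1/p + 1/2))\<close>
  times \<open>2^(1 - k)\<close>: the first factor cancels the bound on sums of rows, the second is
  the decay that remains.\<close>

lemma walsh_coeff_eq:
  assumes "p > 0" "k \<ge> 1"
  shows "walsh_coeff p k = 2 powr (- (1/p + 1/2) * real (k * (k - 1)) - (real k - 1))"
proof -
  have "(real k * (2 + p) + 2 * p) / (2 * p) = real k * (1/p + 1/2) + 1"
    using assms(1) by (simp add: field_simps)
  moreover have "(1 - real k) * (real k * q + 1) = - q * (real k * (real k - 1)) - (real k - 1)" for q
    by (simp add: algebra_simps)
  ultimately show ?thesis
    unfolding walsh_coeff_def real_pronic[OF assms(2)] times_divide_eq_right[symmetric]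
    by (simp only:)
qed

lemma two_power_powr: "((2::real) ^ m) powr x = 2 powr (real m * x)"
  by (simp add: powr_powr flip: powr_realpow)

section \<open>Norms of subsums, in one block and across blocks\<close>

text \<open>At most \<open>M\<close> rows are added, so Parseval bounds the sum of squares by
  \<open>M^2\<close> and the power mean inequality gives \<open>M^(1 + p/2)\<close>. The coefficient
  reduces this to \<open>2^(-(k - 1) p)\<close>.\<close>

lemma walsh_block_subset_sum_bound:
  assumes p: "1 \<le> p" "p \<le> 2" and k: "k \<ge> 1" and D: "D \<subseteq> walsh_block k"
  shows "(\<Sum>i\<in>walsh_block k. \<bar>\<Sum>j\<in>D. walsh_vec p j i\<bar> powr p) \<le> (1/2) ^ (k - 1)"
proof -
  define m where "m = k * (k - 1)"
  define M where "M = (2 ^ m :: nat)"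
  define D' where "D' = (\<lambda>j. j - M) ` D"
  define y where "y s = (\<Sum>r\<in>D'. walsh_sample m r s)" for s
  let ?c = "walsh_coeff p k"
  have block: "walsh_block k = {M..<2 * M}" by (simp add: walsh_block_def M_def m_def)
  have "j - M < 2 ^ m" if "j \<in> D" for j
    using subsetD[OF D that] by (auto simp: block M_def)
  then have D': "D' \<subseteq> {..<2 ^ m}" by (auto simp: D'_def)
  have inj: "inj_on (\<lambda>j. j - M) D"
    using D by (intro inj_onI) (auto simp: block subset_iff eq_diff_iff)
  have vec: "(\<Sum>j\<in>D. walsh_vec p j (M + s - 1)) = ?c * y s" if s: "s \<in> {1..2 ^ m}" for s
  proof -
    have i: "M + s - 1 \<in> walsh_block k" "Suc (M + s - 1 - 2 ^ m) = s"
      using s by (auto simp: block M_def)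
    have "(\<Sum>j\<in>D. walsh_vec p j (M + s - 1)) = (\<Sum>j\<in>D. ?c * walsh_sample m (j - M) s)"
    proof (rule sum.cong)
      fix j assume "j \<in> D"
      then have "j \<in> walsh_block k" using D by auto
      from walsh_vec_in_block[OF k this, of p "M + s - 1", folded m_def]
      show "walsh_vec p j (M + s - 1) = ?c * walsh_sample m (j - M) s"
        using i by (simp add: M_def)
    qed simp
    then show ?thesis by (simp add: y_def D'_def sum.reindex[OF inj] sum_distrib_left)
  qed
  have c: "?c powr p * real M powr (1 + p/2) = 2 powr (- (real k - 1) * p)"
  proof -
    have "?c powr p = 2 powr ((- (1/p + 1/2) * real m - (real k - 1)) * p)"
      using walsh_coeff_eq[of p k] p k by (simp add: powr_powr m_def)
    moreover have "real M powr (1 + p/2) = 2 powr (real m * (1 + p/2))"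
      by (simp add: M_def two_power_powr)
    moreover have "(- (1/p + 1/2) * real m - (real k - 1)) * p + real m * (1 + p/2) = - (real k - 1) * p"
      using p(1) by (simp add: distrib_left distrib_right left_diff_distrib)
    ultimately show ?thesis by (simp only: powr_add[symmetric])
  qed
  have "card D' \<le> M" using card_mono[OF _ D'] by (simp add: M_def)
  then have "real (card D') * 2 ^ m \<le> real M * real M" by (simp add: M_def)
  then have ybound: "(\<Sum>s\<in>{1..2 ^ m}. \<bar>y s\<bar> powr p) \<le> real M powr (1 + p/2)"
    using p walsh_sample_parseval[OF D']
    by (intro sum_powr_le_of_sum_squares) (auto simp: M_def y_def power2_eq_square)
  have "(\<Sum>i\<in>walsh_block k. \<bar>\<Sum>j\<in>D. walsh_vec p j i\<bar> powr p)
      = (\<Sum>s\<in>{1..2 ^ m}. \<bar>\<Sum>j\<in>D. walsh_vec p j (M + s - 1)\<bar> powr p)"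
    by (rule sum.reindex_bij_witness[of _ "\<lambda>s. M + s - 1" "\<lambda>i. i + 1 - M"])
       (auto simp: block M_def[symmetric])
  also have "\<dots> = (\<Sum>s\<in>{1..2 ^ m}. ?c powr p * \<bar>y s\<bar> powr p)"
  proof (intro sum.cong refl)
    fix s assume "s \<in> {1..2 ^ m :: nat}"
    moreover have "?c \<ge> 0" by (simp add: walsh_coeff_def)
    ultimately show "\<bar>\<Sum>j\<in>D. walsh_vec p j (M + s - 1)\<bar> powr p = ?c powr p * \<bar>y s\<bar> powr p"
      by (simp only: vec abs_mult powr_mult abs_of_nonneg abs_ge_zero)
  qed
  also have "\<dots> \<le> ?c powr p * real M powr (1 + p/2)"
    unfolding sum_distrib_left[symmetric] by (intro mult_left_mono ybound) auto
  also have "\<dots> = 2 powr (- (real k - 1) * p)" by (rule c)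
  \<comment> \<open>Here \<open>p \<ge> 1\<close> makes the bound independent of
    \<open>p\<close>.\<close>
  also have "\<dots> \<le> 2 powr (- (real k - 1) * 1)"
    by (intro powr_mono mult_left_mono_neg) (use p k in auto)
  also have "\<dots> = (1/2) ^ (k - 1)"
  proof -
    have "- (real k - 1) * 1 = - real (k - 1)" using k by (simp add: of_nat_diff)
    then show ?thesis by (simp only: powr_minus powr_realpow[of 2] power_one_over inverse_eq_divide)
  qed
  finally show ?thesis .
qed

text \<open>
  The cutoff \<open>2 * i\<close> loses nothing, as \<open>x^(j)\<close> vanishes at \<open>i\<close> for \<open>j > 2 * i\<close>; it makes the
  coordinate \<open>i\<close> of the possibly infinite sum over \<open>E\<close> a finite sum.
\<close>

definition walsh_subsum :: "real \<Rightarrow> nat set \<Rightarrow> nat \<Rightarrow> real" where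
  "walsh_subsum p E i = (\<Sum>j\<in>E \<inter> {1..2 * i}. walsh_vec p j i)"

lemma walsh_subsum_in_block:
  assumes "k \<ge> 1" "i \<in> walsh_block k"
  shows "walsh_subsum p E i = (\<Sum>j\<in>E \<inter> walsh_block k. walsh_vec p j i)"
  unfolding walsh_subsum_def
proof (rule sum.mono_neutral_right)
  have "1 \<le> j" "j \<le> 2 * i" if "j \<in> walsh_block k" for j
    using that assms(2) by (auto simp: walsh_block_def intro: order_trans[rotated])
  then show "E \<inter> walsh_block k \<subseteq> E \<inter> {1..2 * i}" by auto
  show "\<forall>j\<in>E \<inter> {1..2 * i} - E \<inter> walsh_block k. walsh_vec p j i = 0"
    using walsh_vec_nonzero[of _ p i] walsh_block_unique[OF _ assms(2) _ assms(1)] by (metis DiffD1 DiffD2 IntD1 IntD2 IntI atLeastAtMost_iff)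
qed simp

lemma walsh_subsum_nonzero:
  assumes "walsh_subsum p E i \<noteq> 0"
  obtains k j where "k \<ge> 1" "j \<in> E" "j \<in> walsh_block k" "i \<in> walsh_block k"
proof -
  obtain j where j: "j \<in> E" "1 \<le> j" "walsh_vec p j i \<noteq> 0"
    using assms unfolding walsh_subsum_def
    by (metis IntE atLeastAtMost_iff sum.not_neutral_contains_not_neutral)
  show thesis by (rule walsh_vec_nonzero[OF j(2,3)]) (rule that[OF _ j(1)])
qed

text \<open>Only blocks \<open>k \<ge> K\<close> occur, and since their supports are disjoint the
  \<open>p\<close>-th powers add up to at most a geometric series with sum
  \<open>4 * (1/2)^K\<close>.\<close>

lemma walsh_subsum_bound:
  assumes p: "1 \<le> p" "p \<le> 2" and K: "K \<ge> 1" and E: "E \<subseteq> {2 ^ (K * (K - 1))..}"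
  shows "(\<Sum>i<n. \<bar>walsh_subsum p E i\<bar> powr p) \<le> 4 * (1/2) ^ K"
proof -
  let ?T = "\<lambda>i. \<bar>walsh_subsum p E i\<bar> powr p"
  have cover: "?T i \<le> (\<Sum>k=K..<K + n. if i \<in> walsh_block k then ?T i else 0)" if "i < n" for i
  proof (cases "walsh_subsum p E i = 0")
    case False
    then obtain k j where kj: "k \<ge> 1" "j \<in> E" "j \<in> walsh_block k" "i \<in> walsh_block k"
      by (rule walsh_subsum_nonzero)
    have "K \<le> k" using walsh_block_less[OF kj(1) _ kj(3), of K] E kj(2) by (meson atLeast_iff not_le subsetD)
    \<comment> \<open>From \<open>k - 1 < 2^(k - 1) \<le> i < n\<close> it follows that finitely
      many blocks cover the first \<open>n\<close> coordinates.\<close>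
    have "k - 1 \<le> k * (k - 1)" by (cases k) auto
    then have "(2::nat) ^ (k - 1) \<le> i"
      using kj(4) unfolding walsh_block_def
      by (meson atLeastLessThan_iff one_le_numeral order_trans power_increasing)
    then have "k - 1 < i" using less_exp[of "k - 1"] by linarith
    then have "k \<in> {K..<K + n}" using \<open>K \<le> k\<close> K that by auto
    then have "(if i \<in> walsh_block k then ?T i else 0) \<le>
        (\<Sum>k=K..<K + n. if i \<in> walsh_block k then ?T i else 0)"
      by (intro member_le_sum) auto
    then show ?thesis using kj(4) by simp
  qed (auto intro!: sum_nonneg)
  have "(\<Sum>i<n. ?T i) \<le> (\<Sum>i<n. \<Sum>k=K..<K + n. if i \<in> walsh_block k then ?T i else 0)"
    by (intro sum_mono cover) simp
  also have "\<dots> = (\<Sum>k=K..<K + n. \<Sum>i<n. if i \<in> walsh_block k then ?T i else 0)"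
    by (rule sum.swap)
  also have "\<dots> \<le> (\<Sum>k=K..<K + n. (1/2) ^ (k - 1))"
  proof (rule sum_mono)
    fix k assume "k \<in> {K..<K + n}"
    then have k: "k \<ge> 1" using K by simp
    have "(\<Sum>i<n. if i \<in> walsh_block k then ?T i else 0) = (\<Sum>i\<in>{..<n} \<inter> walsh_block k. ?T i)"
      by (simp add: sum.inter_restrict)
    also have "\<dots> \<le> (\<Sum>i\<in>walsh_block k. ?T i)" by (rule sum_mono2) auto
    also have "\<dots> = (\<Sum>i\<in>walsh_block k. \<bar>\<Sum>j\<in>E \<inter> walsh_block k. walsh_vec p j i\<bar> powr p)"
      by (intro sum.cong refl) (simp add: walsh_subsum_in_block[OF k])
    also have "\<dots> \<le> (1/2) ^ (k - 1)" by (rule walsh_block_subset_sum_bound[OF p k]) simp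
    finally show "(\<Sum>i<n. if i \<in> walsh_block k then ?T i else 0) \<le> (1/2) ^ (k - 1)" .
  qed
  also have "\<dots> \<le> 4 * (1/2) ^ K"
  proof -
    have "(\<Sum>k=K..<K + n. (1/2::real) ^ (k - 1)) = 4 * (1/2) ^ K - 4 * (1/2) ^ (K + n)"
    proof (induction n)
      case (Suc n)
      have "(1/2::real) ^ (K + n) = (1/2) ^ (K + n - 1) / 2"
        using K power_Suc[of "1/2::real" "K + n - 1"] by simp
      then show ?case using Suc by simp
    qed simp
    then show ?thesis by simp
  qed
  finally show ?thesis .
qed

lemma walsh_subsum_summable:
  assumes p: "1 \<le> p" "p \<le> 2" and K: "K \<ge> 1" and E: "E \<subseteq> {2 ^ (K * (K - 1))..}"
  shows "summable (\<lambda>i. \<bar>walsh_subsum p E i\<bar> powr p)"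
    and "(\<Sum>i. \<bar>walsh_subsum p E i\<bar> powr p) \<le> 4 * (1/2) ^ K"
proof -
  show *: "summable (\<lambda>i. \<bar>walsh_subsum p E i\<bar> powr p)"
    by (rule summableI_nonneg_bounded[where x="4 * (1/2) ^ K"]) (auto intro: walsh_subsum_bound[OF assms])
  show "(\<Sum>i. \<bar>walsh_subsum p E i\<bar> powr p) \<le> 4 * (1/2) ^ K"
    by (rule suminf_le_const[OF *]) (rule walsh_subsum_bound[OF assms])
qed

lemma walsh_subsum_mem_lp:
  assumes "1 \<le> p" "p \<le> 2" "E \<subseteq> {1..}"
  shows "walsh_subsum p E \<in> lp p"
proof -
  \<comment> \<open>The choice \<open>K = 1\<close> makes the lower end of the range equal to
    1.\<close>
  have "E \<subseteq> {2 ^ (1 * (1 - 1))..}" using assms(3) by simp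
  from walsh_subsum_summable(1)[OF assms(1,2) order_refl this]
  have "summable (\<lambda>i. \<bar>walsh_subsum p E i\<bar> powr p)" .
  moreover have "walsh_subsum p E 0 = 0" by (simp add: walsh_subsum_def)
  ultimately show ?thesis by (simp only: lp_def mem_Collect_eq)
qed

lemma walsh_subsum_finite:
  assumes "finite F" "F \<subseteq> {1..}"
  shows "walsh_subsum p F i = (\<Sum>j\<in>F. walsh_vec p j i)"
  unfolding walsh_subsum_def
proof (rule sum.mono_neutral_left[OF assms(1)])
  have "walsh_vec p j i = 0" if "j \<in> F" "j > 2 * i" for j
  proof (rule ccontr)
    assume "walsh_vec p j i \<noteq> 0"
    moreover have "j \<ge> 1" using that assms by auto
    ultimately obtain k where "j \<in> walsh_block k" "i \<in> walsh_block k" using walsh_vec_nonzero by blast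
    then show False using that by (auto simp: walsh_block_def)
  qed
  then show "\<forall>j\<in>F - F \<inter> {1..2 * i}. walsh_vec p j i = 0"
    using assms(2) by (auto simp: subset_iff) (meson not_le)
qed auto

text \<open>The error of a partial sum is, up to sign, the subsum over the omitted indices, to which
  the tail bound applies.\<close>

lemma walsh_subsum_diff:
  assumes "finite F" "F \<subseteq> {1..}"
  shows "(\<Sum>j\<in>F. walsh_vec p j i) - walsh_subsum p {1..} i = - walsh_subsum p ({1..} - F) i"
proof -
  have "{1..} \<inter> {1..2 * i} = F \<inter> {1..2 * i} \<union> ({1..} - F) \<inter> {1..2 * i}" using assms by auto
  then have "walsh_subsum p {1..} i = walsh_subsum p F i + walsh_subsum p ({1..} - F) i"
    unfolding walsh_subsum_def by (simp only:) (rule sum.union_disjoint; auto)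
  then show ?thesis using walsh_subsum_finite[OF assms] by simp
qed

section \<open>Convergence of all rearrangements\<close>

text \<open>The finitely many indices below \<open>X\<close> sit at positions bounded by some
  \<open>B\<close>, so after \<open>B\<close> terms all of them have been used.\<close>

lemma bij_betw_images_exhaust:
  fixes \<pi> :: "nat \<Rightarrow> nat"
  assumes "bij_betw \<pi> {1..} {1..}"
  shows "\<forall>\<^sub>F N in sequentially. {1..} - \<pi> ` {1..N} \<subseteq> {X..}"
proof -
  define \<rho> where "\<rho> = inv_into {1..} \<pi>"
  have "finite (\<rho> ` {1..<X})" by simp
  then obtain B where B: "\<And>n. n \<in> \<rho> ` {1..<X} \<Longrightarrow> n \<le> B"
    by (meson finite_nat_set_iff_bounded_le)
  have "{1..} - \<pi> ` {1..N} \<subseteq> {X..}" if "N \<ge> B" for N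
  proof
    fix j assume j: "j \<in> {1..} - \<pi> ` {1..N}"
    then have "j \<in> \<pi> ` {1..}" using assms by (auto simp: bij_betw_def)
    then have "\<rho> j \<in> {1..}" "\<pi> (\<rho> j) = j"
      unfolding \<rho>_def by (rule inv_into_into, rule f_inv_into_f)
    then have "\<rho> j > N" using j by (metis DiffD2 atLeastAtMost_iff atLeast_iff imageI not_le)
    then have "j \<notin> {1..<X}" using B[of "\<rho> j"] that by force
    then show "j \<in> {X..}" using j by auto
  qed
  then show ?thesis unfolding eventually_sequentially by blast
qed

text \<open>The common limit is the coordinatewise sum \<open>walsh_subsum p {1..}\<close>, which
  does not depend on the rearrangement. The omitted indices eventually lie beyond any given block,
  so the errors tend to 0.\<close>

lemma walsh_vec_unconditionally_summable:
  assumes p: "1 \<le> p" "p \<le> 2"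
  shows "lp_unconditionally_summable p (walsh_vec p)"
  unfolding lp_unconditionally_summable_def
proof (intro conjI allI impI bexI[of _ "walsh_subsum p {1..}"])
  fix j :: nat assume j: "j \<ge> 1"
  then have "walsh_vec p j = walsh_subsum p {j}" by (auto simp: walsh_subsum_finite)
  then show "walsh_vec p j \<in> lp p" using walsh_subsum_mem_lp[OF p, of "{j}"] j by simp
next
  show "walsh_subsum p {1..} \<in> lp p" by (rule walsh_subsum_mem_lp[OF p]) simp
next
  fix \<pi> :: "nat \<Rightarrow> nat" assume \<pi>: "bij_betw \<pi> {1..} {1..}"
  define R where "R N = {1..} - \<pi> ` {1..N}" for N :: nat
  define s where "s N = (\<Sum>i. \<bar>walsh_subsum p (R N) i\<bar> powr p)" for N
  have norm: "lp_norm p (\<lambda>i. (\<Sum>j=1..N. walsh_vec p (\<pi> j) i) - walsh_subsum p {1..} i) = s N powr (1/p)" for N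
  proof -
    have "inj_on \<pi> {1..N}" using \<pi> by (rule bij_betw_imp_inj_on[THEN inj_on_subset]) auto
    moreover have "\<pi> ` {1..N} \<subseteq> {1..}" using bij_betw_imp_surj_on[OF \<pi>] by auto
    ultimately have "(\<Sum>j=1..N. walsh_vec p (\<pi> j) i) - walsh_subsum p {1..} i = - walsh_subsum p (R N) i" for i
      using walsh_subsum_diff[of "\<pi> ` {1..N}" p i] by (simp add: sum.reindex R_def)
    then show ?thesis by (simp add: lp_norm_def s_def)
  qed
  have "R N \<subseteq> {2 ^ (1 * (1 - 1))..}" for N by (auto simp: R_def)
  then have s_nonneg: "0 \<le> s N" for N
    unfolding s_def by (intro suminf_nonneg walsh_subsum_summable(1)[OF p order_refl]) auto
  have "s \<longlonglongrightarrow> 0"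
  proof (rule order_tendstoI)
    fix a :: real assume "a < 0"
    then show "\<forall>\<^sub>F N in sequentially. a < s N" using s_nonneg by (intro always_eventually allI) (meson less_le_trans)
  next
    fix a :: real assume "0 < a"
    have "(\<lambda>K. 4 * (1/2::real) ^ K) \<longlonglongrightarrow> 4 * 0" by (intro tendsto_intros) auto
    then have "\<forall>\<^sub>F K in sequentially. 4 * (1/2::real) ^ K < a \<and> K \<ge> 1"
      using \<open>0 < a\<close> by (intro eventually_conj order_tendstoD(2)[where a = a] eventually_ge_at_top) auto
    then obtain K where K: "4 * (1/2::real) ^ K < a" "K \<ge> 1"
      using eventually_happens'[OF sequentially_bot] by blast
    show "\<forall>\<^sub>F N in sequentially. s N < a"
      using bij_betw_images_exhaust[OF \<pi>, of "2 ^ (K * (K - 1))"]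
    proof eventually_elim
      case (elim N)
      then show ?case
        using walsh_subsum_summable(2)[OF p K(2), of "R N"] K(1) by (simp add: R_def s_def)
    qed
  qed
  then have "(\<lambda>N. s N powr (1/p)) \<longlonglongrightarrow> 0"
    by (rule tendsto_zero_powrI[OF _ tendsto_const]) (use p s_nonneg in auto)
  then show "(\<lambda>N. lp_norm p (\<lambda>i. (\<Sum>j=1..N. walsh_vec p (\<pi> j) i) - walsh_subsum p {1..} i)) \<longlonglongrightarrow> 0"
    unfolding norm .
qed

section \<open>Divergence of the powers of the norms\<close>

text \<open>All \<open>M\<close> coordinates in the block have modulus
  \<open>walsh_coeff p k\<close>, so the norm is \<open>M^(1/p)\<close> times it; the dependence on
  \<open>p\<close> cancels.\<close>

lemma lp_norm_walsh_vec:
  assumes "p > 0" "k \<ge> 1" "j \<in> walsh_block k"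
  shows "lp_norm p (walsh_vec p j) = 2 powr (- (real k - 1) * (real k / 2 + 1))"
proof -
  define m where "m = k * (k - 1)"
  let ?c = "walsh_coeff p k"
  have c: "?c > 0" by (simp add: walsh_coeff_def)
  have abs: "\<bar>walsh_vec p j i\<bar> powr p = (if i \<in> walsh_block k then ?c powr p else 0)" for i
  proof -
    have "\<bar>walsh_sample m (j - 2 ^ m) (Suc (i - 2 ^ m))\<bar> = 1" if "i \<in> walsh_block k"
      using that assms(3) by (intro abs_walsh_sample) (auto simp: walsh_block_def m_def)
    then show ?thesis
      using walsh_vec_in_block[OF assms(2,3), of p i] c by (simp add: m_def abs_mult)
  qed
  have "(\<Sum>i. \<bar>walsh_vec p j i\<bar> powr p) = (\<Sum>i\<in>walsh_block k. ?c powr p)"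
    unfolding abs by (subst suminf_finite[of "walsh_block k"]) auto
  also have "\<dots> = 2 ^ m * ?c powr p" by (simp add: m_def)
  finally have "lp_norm p (walsh_vec p j) = 2 powr (real m / p) * ?c"
    using assms(1) c by (simp add: lp_norm_def powr_mult two_power_powr powr_powr)
  also have "\<dots> = 2 powr (- (real k - 1) * (real k / 2 + 1))"
    unfolding walsh_coeff_eq[OF assms(1,2)] powr_add[symmetric] m_def real_pronic[OF assms(2)]
    by (intro arg_cong[where f="\<lambda>x. 2 powr x"]) (use assms(1) in \<open>simp add: field_simps\<close>)
  finally show ?thesis .
qed

lemma walsh_vec_norm_powers_diverge:
  assumes p: "p > 0" and \<epsilon>: "\<epsilon> > 0"
  shows "(\<Sum>j. ennreal (lp_norm p (walsh_vec p (Suc j)) powr (2 - \<epsilon>))) = \<infinity>" (is "?S = _")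
proof -
  have bound: "of_nat n \<le> ?S" for n
  proof -
    \<comment> \<open>The constant 6 ensures
      \<open>k \<epsilon> / 2 - 2 + \<epsilon> \<ge> 1\<close>, so that block \<open>k\<close> alone
      contributes at least \<open>2^(k - 1)\<close>; adding \<open>n\<close> to \<open>q\<close> in
      \<open>k\<close> pushes this above \<open>n\<close>.\<close>
    obtain q :: nat where q: "6 / \<epsilon> \<le> real q" using real_arch_simple by blast
    define k where "k = Suc (n + q)"
    define m where "m = k * (k - 1)"
    define v where "v = 2 powr (- (real k - 1) * (real k / 2 + 1) * (2 - \<epsilon>))"
    \<comment> \<open>This is the block shifted down by one, as the series runs over
      \<open>Suc j\<close>.\<close>
    let ?I = "{2 ^ m - 1..<2 * 2 ^ m - 1} :: nat set"
    have k: "k \<ge> 1" by (simp add: k_def)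
    have "6 \<le> real k * \<epsilon>"
    proof -
      have "6 \<le> real q * \<epsilon>" using q \<epsilon> by (simp add: field_simps)
      also have "\<dots> \<le> real k * \<epsilon>" using \<epsilon> by (intro mult_right_mono) (auto simp: k_def)
      finally show ?thesis .
    qed
    then have "real k - 1 \<le> (real k - 1) * (real k * \<epsilon> / 2 - 2 + \<epsilon>)"
      using \<epsilon> k mult_left_mono[of 1 "real k * \<epsilon> / 2 - 2 + \<epsilon>" "real k - 1"] by simp
    also have "\<dots> = real m + - (real k - 1) * (real k / 2 + 1) * (2 - \<epsilon>)"
      unfolding m_def real_pronic[OF k] by (simp add: field_simps)
    finally have "2 powr (real k - 1) \<le> 2 powr real m * v"
      unfolding v_def powr_add[symmetric] by (intro powr_mono) auto
    moreover have "real n \<le> 2 powr (real k - 1)"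
    proof -
      have "n < 2 ^ n" by (rule less_exp)
      then have "real n \<le> 2 ^ n" by (metis less_imp_le of_nat_le_iff of_nat_numeral of_nat_power)
      also have "\<dots> = 2 powr real n" by (simp add: powr_realpow)
      also have "\<dots> \<le> 2 powr (real k - 1)" by (intro powr_mono) (auto simp: k_def)
      finally show ?thesis .
    qed
    ultimately have "real n \<le> 2 ^ m * v" by (simp add: powr_realpow)
    then have "of_nat n \<le> ennreal (2 ^ m * v)"
      by (metis ennreal_leI ennreal_of_nat_eq_real_of_nat)
    also have "\<dots> = (\<Sum>j\<in>?I. ennreal v)"
      by (subst sum_ennreal) (auto simp: v_def)
    also have "\<dots> = (\<Sum>j\<in>?I. ennreal (lp_norm p (walsh_vec p (Suc j)) powr (2 - \<epsilon>)))"
    proof (rule sum.cong)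
      fix j assume "j \<in> ?I"
      then have "Suc j \<in> walsh_block k" by (auto simp: walsh_block_def m_def)
      then show "ennreal v = ennreal (lp_norm p (walsh_vec p (Suc j)) powr (2 - \<epsilon>))"
        by (simp add: lp_norm_walsh_vec[OF p k] v_def powr_powr)
    qed simp
    also have "\<dots> \<le> ?S" by (rule sum_le_suminf) auto
    finally show ?thesis .
  qed
  show ?thesis
  proof (rule ccontr)
    assume "?S \<noteq> \<infinity>"
    then have "?S < top" by (simp add: less_top)
    then obtain n where "?S < of_nat n" using ennreal_Ex_less_of_nat by blast
    then show False using bound[of n] by simp
  qed
qed

text \<open>Summing in \<open>ennreal\<close> expresses divergence as the value infinity. Zero
  vectors contribute 0 for every \<epsilon>, since \<open>0 powr a = 0\<close>.\<close>

theorem theorem3p1: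
  fixes p :: real
  assumes "1 \<le> p" and "p \<le> 2"
  shows "(\<forall>j\<ge>1. \<forall>k\<in>index_set j. \<forall>k'\<in>index_set j. k = k') \<and>
         lp_unconditionally_summable p (walsh_vec p) \<and>
         (\<forall>\<epsilon>>0. (\<Sum>j. ennreal (lp_norm p (walsh_vec p (Suc j)) powr (2 - \<epsilon>))) = \<infinity>)"
proof (intro conjI allI impI ballI)
  fix j k k' :: nat assume "j \<ge> 1" "k \<in> index_set j" "k' \<in> index_set j"
  then show "k = k'" using index_set_iff walsh_block_unique by blast
next
  show "lp_unconditionally_summable p (walsh_vec p)"
    by (rule walsh_vec_unconditionally_summable[OF assms])
next
  fix \<epsilon> :: real assume "\<epsilon> > 0"
  then show "(\<Sum>j. ennreal (lp_norm p (walsh_vec p (Suc j)) powr (2 - \<epsilon>))) = \<infinity>"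
    by (rule walsh_vec_norm_powers_diverge[rotated]) (use assms in simp)
qed

end
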